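(* Let $k>0$ and $\varphi(p)=e^{kp^0}$. For functions $f,h$ on $[0,1]\times\mathbb{R}^3$ and each $x_1\in[0,1]$, $p\in\mathbb{R}^3$, $$|(\mathcal{L}f-\mathcal{L}h)(x_1,p)|\le C\min\Big\{(p^0)^{1/2}\|f(x_1,\cdot)-h(x_1,\cdot)\|_{L^1_{p,1/2}},\ e^{-\frac{k}{\sqrt2}}(p^0)^{1/2}\|f-h\|\Big\},$$ where $C>0$ is a constant depending only on the scattering kernel.
   Context: Notation. For $p\in\mathbb{R}^3$: $p^0=\sqrt{1+|p|^2}$. For $p,q\in\mathbb{R}^3$: $g=g(p,q)=\sqrt{|p-q|^2-(p^0-q^0)^2}$, $s=g^2+4$, $v_{\o}=\dfrac{g\sqrt s}{p^0q^0}$. For $\omega\in\mathbb{S}^2$ and $\gamma=(p^0+q^0)/\sqrt s$, set $p'=\frac{p+q}2+\frac g2\big(\omega+(\gamma-1)(p+q)\frac{(p+q)\cdot\omega}{|p+q|^2}\big)$, $q'=p+q-p'$; the scattering angle $\theta$ is given by $\cos\theta=g^{-2}\big[-(p^0-q^0)(p'^0-q'^0)+(p-q)\cdot(p'-q')\big]$. Scattering kernel (hard spheres). $\sigma(g,\theta)\ge0$ is measurable with $\sigma(g,\theta)\approx g\,\sigma_0(\theta)$ (two-sided bounds with fixed positive constants), where $0\le\sigma_0(\theta)\le\frac1{4\pi}$ is measurable and $\int_{\mathbb{S}^2}\sigma_0(\theta)\,d\omega=c_0\le1$. Loss operator: $\mathcal{L}f(x_1,p)=\int_{\mathbb{R}^3}\int_{\mathbb{S}^2}v_{\o}\,\sigma(g,\theta)f(x_1,q)\,d\omega\,dq$.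 Norms: $\|u(x_1,\cdot)\|_{L^1_{p,1/2}}=\int_{\mathbb{R}^3}(p^0)^{1/2}|u(x_1,p)|\,dp$ and $\|u\|=\int_{\mathbb{R}^3}\operatorname{ess\,sup}_{x_1\in[0,1]}|u(x_1,p)|\,(p^0)^{1/2}\varphi(p)\,dp$. Here $f,h$ are measurable functions for which $\mathcal{L}f,\mathcal{L}h$ and the norms of $f-h$ are finite; since the norm $\|\cdot\|$ uses an essential supremum, pointwise statements in $x_1$ are understood for almost every $x_1$. *)

theory Defs
  imports "HOL-Analysis.Analysis" "HOL-Probability.Essential_Supremum"
begin

definition energy :: "real^3 \<Rightarrow> real" where
  "energy p = sqrt (1 + (norm p)\<^sup>2)"

definition rel_g :: "real^3 \<Rightarrow> real^3 \<Rightarrow> real" where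
  "rel_g p q = sqrt ((norm (p - q))\<^sup>2 - (energy p - energy q)\<^sup>2)"

definition rel_s :: "real^3 \<Rightarrow> real^3 \<Rightarrow> real" where
  "rel_s p q = (rel_g p q)\<^sup>2 + 4"

definition moller :: "real^3 \<Rightarrow> real^3 \<Rightarrow> real" where
  "moller p q = rel_g p q * sqrt (rel_s p q) / (energy p * energy q)"

definition post_p :: "real^3 \<Rightarrow> real^3 \<Rightarrow> real^3 \<Rightarrow> real^3" where
  "post_p p q \<omega> =
     (let \<gamma> = (energy p + energy q) / sqrt (rel_s p q) in
      (1/2) *\<^sub>R (p + q) + (rel_g p q / 2) *\<^sub>R
        (\<omega> + ((\<gamma> - 1) * (((p + q) \<bullet> \<omega>) / (norm (p + q))\<^sup>2)) *\<^sub>R (p + q)))"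

definition post_q :: "real^3 \<Rightarrow> real^3 \<Rightarrow> real^3 \<Rightarrow> real^3" where
  "post_q p q \<omega> = p + q - post_p p q \<omega>"

text \<open>The angle is taken in \<open>[0, \<pi>]\<close>. For \<open>p \<noteq> q\<close> the argument of \<open>arccos\<close> lies in
  \<open>[-1, 1]\<close>; for \<open>p = q\<close> division by zero makes the value \<open>\<pi> / 2\<close>, which is irrelevant since
  \<open>moller p p = 0\<close>.\<close>

definition scatter_angle :: "real^3 \<Rightarrow> real^3 \<Rightarrow> real^3 \<Rightarrow> real" where
  "scatter_angle p q \<omega> = arccos
     ((- (energy p - energy q) * (energy (post_p p q \<omega>) - energy (post_q p q \<omega>))
        + (p - q) \<bullet> (post_p p q \<omega> - post_q p q \<omega>)) / (rel_g p q)\<^sup>2)"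

text \<open>Surface measure on the unit sphere as the cone measure: the area of \<open>A\<close> is three times the
  volume of \<open>{r *\<^sub>R \<omega> | r \<omega>. 0 < r \<le> 1 \<and> \<omega> \<in> A}\<close>, which is the polar-coordinate formula.\<close>

definition sphere_measure :: "(real^3) measure" where
  "sphere_measure = distr (density (restrict_space lborel (cball 0 1 - {0})) (\<lambda>_. 3))
     (restrict_space borel (sphere 0 1)) sgn"

lemma emeasure_sphere_measure:
  assumes "A \<in> sets (restrict_space borel (sphere 0 1))"
  shows "emeasure sphere_measure A = 3 * emeasure lborel {x \<in> cball 0 1 - {0}. sgn x \<in> A}"
proof -
  let ?R = "restrict_space lborel (cball 0 1 - {0}) :: (real^3) measure"
  have sgn: "sgn \<in> measurable ?R (restrict_space borel (sphere 0 1))"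
    by (rule measurable_restrict_space2)
       (auto simp: space_restrict_space norm_sgn sgn_div_norm intro!: measurable_restrict_space1)
  have pre: "sgn -` A \<inter> space ?R = {x \<in> cball 0 1 - {0}. sgn x \<in> A}"
    by (auto simp: space_restrict_space)
  have mem: "{x \<in> cball 0 1 - {0}. sgn x \<in> A} \<in> sets ?R"
    using measurable_sets[OF sgn assms] by (simp only: pre)
  have sgn': "sgn \<in> measurable (density ?R (\<lambda>_. 3)) (restrict_space borel (sphere 0 1))"
    using sgn by simp
  have "emeasure sphere_measure A = emeasure (density ?R (\<lambda>_. 3)) {x \<in> cball 0 1 - {0}. sgn x \<in> A}"
    unfolding sphere_measure_def
    by (subst emeasure_distr[OF sgn' assms]) (simp only: space_density pre)
  also have "\<dots> = 3 * emeasure ?R {x \<in> cball 0 1 - {0}. sgn x \<in> A}"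
    by (rule emeasure_density_const[OF mem])
  also have "emeasure ?R {x \<in> cball 0 1 - {0}. sgn x \<in> A}
      = emeasure lborel {x \<in> cball 0 1 - {0}. sgn x \<in> A}"
    by (rule emeasure_restrict_space) auto
  finally show ?thesis .
qed

lemma emeasure_sphere_measure_space: "emeasure sphere_measure (sphere 0 1) = ennreal (4 * pi)"
proof -
  have 1: "{x \<in> cball 0 1 - {0}. sgn x \<in> sphere 0 1} = cball (0 :: real^3) 1 - {0}"
    by (auto simp: norm_sgn)
  have "sphere (0 :: real^3) 1 \<in> sets (restrict_space borel (sphere 0 1))"
    by (simp add: sets_restrict_space_iff)
  then have "emeasure sphere_measure (sphere 0 1) = 3 * emeasure lborel (cball (0 :: real^3) 1 - {0})"
    by (simp only: emeasure_sphere_measure 1)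
  also have "emeasure lborel (cball (0 :: real^3) 1 - {0}) = emeasure lborel (cball (0 :: real^3) 1)"
    by (intro emeasure_Diff_null_set) auto
  also have "\<dots> = ennreal (4 / 3 * pi)"
    by (simp add: emeasure_cball unit_ball_vol_3)
  also have "3 * ennreal (4 / 3 * pi) = ennreal (3 * (4 / 3 * pi))"
    by (subst ennreal_mult) auto
  finally show ?thesis by simp
qed

definition hard_sphere_kernel ::
  "(real \<Rightarrow> real \<Rightarrow> real) \<Rightarrow> (real \<Rightarrow> real) \<Rightarrow> real \<Rightarrow> bool" where
  "hard_sphere_kernel \<sigma> \<sigma>\<^sub>0 c\<^sub>0 \<longleftrightarrow>
     (\<lambda>(g, \<theta>). \<sigma> g \<theta>) \<in> borel_measurable (restrict_space borel ({0..} \<times> {0..pi})) \<and>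
     \<sigma>\<^sub>0 \<in> borel_measurable (restrict_space borel {0..pi}) \<and>
     (\<forall>g\<ge>0. \<forall>\<theta>\<in>{0..pi}. 0 \<le> \<sigma> g \<theta>) \<and>
     (\<forall>\<theta>\<in>{0..pi}. 0 \<le> \<sigma>\<^sub>0 \<theta> \<and> \<sigma>\<^sub>0 \<theta> \<le> 1 / (4 * pi)) \<and>
     (\<exists>a>0. \<exists>b>0. \<forall>g\<ge>0. \<forall>\<theta>\<in>{0..pi}.
        a * (g * \<sigma>\<^sub>0 \<theta>) \<le> \<sigma> g \<theta> \<and> \<sigma> g \<theta> \<le> b * (g * \<sigma>\<^sub>0 \<theta>)) \<and>
     (\<forall>p q. p \<noteq> q \<longrightarrow> (LINT \<omega>|sphere_measure. \<sigma>\<^sub>0 (scatter_angle p q \<omega>)) = c\<^sub>0) \<and>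
     c\<^sub>0 \<le> 1"

definition loss_integrand ::
  "(real \<Rightarrow> real \<Rightarrow> real) \<Rightarrow> (real \<Rightarrow> real^3 \<Rightarrow> real) \<Rightarrow> real \<Rightarrow> real^3 \<Rightarrow> real^3 \<Rightarrow> real^3 \<Rightarrow> real" where
  "loss_integrand \<sigma> f x p q \<omega> = moller p q * \<sigma> (rel_g p q) (scatter_angle p q \<omega>) * f x q"

definition loss_op ::
  "(real \<Rightarrow> real \<Rightarrow> real) \<Rightarrow> (real \<Rightarrow> real^3 \<Rightarrow> real) \<Rightarrow> real \<Rightarrow> real^3 \<Rightarrow> real" where
  "loss_op \<sigma> f x p = (LINT q|lebesgue. LINT \<omega>|sphere_measure. loss_integrand \<sigma> f x p q \<omega>)"

text \<open>Finiteness of the loss term: the double integral converges absolutely. Without it the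
  Bochner integral in \<open>loss_op\<close> would silently be \<open>0\<close>.\<close>

definition loss_finite ::
  "(real \<Rightarrow> real \<Rightarrow> real) \<Rightarrow> (real \<Rightarrow> real^3 \<Rightarrow> real) \<Rightarrow> real \<Rightarrow> real^3 \<Rightarrow> bool" where
  "loss_finite \<sigma> f x p \<longleftrightarrow>
     integrable (lebesgue \<Otimes>\<^sub>M sphere_measure) (\<lambda>(q, \<omega>). loss_integrand \<sigma> f x p q \<omega>)"

definition norm_L1_half :: "(real^3 \<Rightarrow> real) \<Rightarrow> ennreal" where
  "norm_L1_half u = (\<integral>\<^sup>+p. ennreal (energy p powr (1/2) * \<bar>u p\<bar>) \<partial>lebesgue)"

definition norm_weighted :: "(real^3 \<Rightarrow> real) \<Rightarrow> (real \<Rightarrow> real^3 \<Rightarrow> real) \<Rightarrow> ennreal" where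
  "norm_weighted \<phi> u =
     (\<integral>\<^sup>+p. esssup (lebesgue_on {0..1}) (\<lambda>x. ennreal \<bar>u x p\<bar>)
        * ennreal (energy p powr (1/2) * \<phi> p) \<partial>lebesgue)"

end

theory Submission
  imports Defs
begin

text \<open>The Moller velocity is at most \<open>4\<close>, the kernel is at most a constant times \<open>g\<close>, and
  \<open>g \<le> 2 * sqrt (energy p * energy q)\<close>; integrating over the sphere, which has area \<open>4 * pi\<close>,
  gives the \<open>L\<^sup>1\<close> bound. The second bound follows, because \<open>1 \<le> exp (- k / sqrt 2) * exp (k * energy q)\<close>
  and the values of \<open>f - h\<close> lie below the essential supremum for almost every \<open>x\<close> and almost
  every \<open>q\<close>. The kernel bounds are available for angles in \<open>[0, \<pi>]\<close> only, and \<open>arccos\<close> takes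
  values there only on \<open>[-1, 1]\<close>, so the cosine of the scattering angle has to be bounded as well:
  in the centre-of-momentum frame it is an inner product of unit vectors.\<close>

section \<open>Integration without measurability, and almost-everywhere bounds on sections\<close>

text \<open>Dividing a simple function below \<open>r * f\<close> by \<open>r\<close> gives one
  below \<open>f\<close>. No measurability of \<open>f\<close> enters, so the bound applies to
  integrands that contain an essential supremum.\<close>

lemma nn_integral_cmult_le:
  assumes "0 < r"
  shows "(\<integral>\<^sup>+x. ennreal r * f x \<partial>M) \<le> ennreal r * (\<integral>\<^sup>+x. f x \<partial>M)"
  unfolding nn_integral_def[of M "\<lambda>x. ennreal r * f x"]
proof (rule SUP_least, clarify)
  fix s assume s: "simple_function M s" "s \<le> (\<lambda>x. ennreal r * f x)"
  have [simp]: "ennreal r * (ennreal (inverse r) * y) = y" "ennreal (inverse r) * (ennreal r * y) = y" for y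
    using assms by (simp_all add: mult.assoc[symmetric] ennreal_mult''[symmetric])
  have s': "simple_function M (\<lambda>x. ennreal (inverse r) * s x)"
    using s(1) by auto
  have "integral\<^sup>S M s = ennreal r * integral\<^sup>S M (\<lambda>x. ennreal (inverse r) * s x)"
    by (subst simple_integral_mult[OF s', symmetric]) simp
  also have "\<dots> \<le> ennreal r * (\<integral>\<^sup>+x. f x \<partial>M)"
  proof (rule mult_left_mono)
    have "ennreal (inverse r) * s x \<le> f x" for x
      using mult_left_mono[OF le_funD[OF s(2), of x], of "ennreal (inverse r)"] by simp
    then show "integral\<^sup>S M (\<lambda>x. ennreal (inverse r) * s x) \<le> integral\<^sup>N M f"
      by (subst nn_integral_eq_simple_integral[OF s', symmetric]) (auto intro: nn_integral_mono)
  qed simp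
  finally show "integral\<^sup>S M s \<le> ennreal r * (\<integral>\<^sup>+x. f x \<partial>M)" .
qed

text \<open>A countable cover by sets of finite measure survives completion. This makes Fubini and
  Tonelli available for \<open>lebesgue\<close>.\<close>

lemma sigma_finite_completion:
  assumes "sigma_finite_measure M"
  shows "sigma_finite_measure (completion M)"
proof -
  from assms obtain A where "countable A" "A \<subseteq> sets M" "\<Union>A = space M" "\<forall>a\<in>A. emeasure M a \<noteq> \<infinity>"
    using sigma_finite_measure.sigma_finite_countable by metis
  then show ?thesis
    by (intro sigma_finite_measure.intro exI[of _ A]) (auto simp: subset_eq)
qed

text \<open>\<open>f \<le> e\<close> need not be a measurable event, so \<open>e\<close> is replaced by the levels \<open>r\<close> of a countable
  dense set: \<open>B r\<close> collects the sections that are almost everywhere at most \<open>r\<close>.\<close>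

lemma (in pair_sigma_finite) AE_commute_le:
  fixes f :: "'a \<times> 'b \<Rightarrow> 'c :: {second_countable_topology, linorder_topology, dense_linorder}"
  assumes [measurable]: "f \<in> borel_measurable (M1 \<Otimes>\<^sub>M M2)"
    and e: "AE y in M2. AE x in M1. f (x, y) \<le> e y"
  shows "AE x in M1. AE y in M2. f (x, y) \<le> e y"
proof -
  obtain D :: "'c set" where D: "countable D" "\<And>X. open X \<Longrightarrow> X \<noteq> {} \<Longrightarrow> \<exists>d\<in>D. d \<in> X"
    using countable_dense_setE by metis
  define B where "B r = {y \<in> space M2. emeasure M1 {x \<in> space M1. r < f (x, y)} = 0}" for r
  have [measurable]: "B r \<in> sets M2" for r
    unfolding B_def by measurable
  have B: "y \<in> B r \<longleftrightarrow> (AE x in M1. f (x, y) \<le> r)" if "y \<in> space M2" for y r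
    using that by (auto simp: B_def AE_iff_measurable[OF _ refl] not_le)
  \<comment> \<open>For a fixed level the condition defines a measurable set of pairs, so the two
    quantifiers commute. Countability of \<open>D\<close> then merges the exceptional sets of all
    levels.\<close>
  have "AE x in M1. AE y in M2. y \<in> B r \<longrightarrow> f (x, y) \<le> r" for r
  proof (subst AE_commute)
    show "AE y in M2. AE x in M1. y \<in> B r \<longrightarrow> f (x, y) \<le> r"
    proof (rule AE_I2)
      fix y assume "y \<in> space M2"
      then show "AE x in M1. y \<in> B r \<longrightarrow> f (x, y) \<le> r"
        by (cases "y \<in> B r") (simp_all add: B)
    qed
  qed measurable
  then have "AE x in M1. \<forall>r\<in>D. AE y in M2. y \<in> B r \<longrightarrow> f (x, y) \<le> r"
    using D(1) by (simp add: AE_ball_countable)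
  then have "AE x in M1. AE y in M2. \<forall>r\<in>D. y \<in> B r \<longrightarrow> f (x, y) \<le> r"
    using D(1) by (simp add: AE_ball_countable)
  then show ?thesis
  proof eventually_elim
    case (elim x)
    from elim e AE_space show ?case
    proof eventually_elim
      case (elim y)
      show ?case
      proof (rule ccontr)
        assume "\<not> f (x, y) \<le> e y"
        then have "{e y <..< f (x, y)} \<noteq> {}"
          by (simp add: not_le)
        then obtain r where r: "r \<in> D" "e y < r" "r < f (x, y)"
          using D(2)[OF open_greaterThanLessThan] by (metis greaterThanLessThan_iff)
        from elim(2) have "AE x' in M1. f (x', y) \<le> r"
          by eventually_elim (use r(2) in auto)
        then have "y \<in> B r"
          using B[OF elim(3)] by simp
        with elim(1) r show False by force
      qed
    qed
  qed
qed

text \<open>For each \<open>q\<close> the bound holds for almost every \<open>x\<close>, and the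
  quantifiers are to be exchanged. Since \<open>u\<close> is only Lebesgue measurable on the
  product, it is extended by zero and replaced by a Borel function \<open>v\<close> off a null set
  \<open>N\<close>; the exchange is carried out for \<open>v\<close>.\<close>

lemma AE_section_le_esssup:
  fixes u :: "real \<Rightarrow> 'b::euclidean_space \<Rightarrow> real"
  assumes "(\<lambda>(x, q). u x q) \<in> borel_measurable (lebesgue_on (S \<times> UNIV))"
    and S: "S \<in> sets borel"
  shows "AE x in lebesgue_on S. AE q in lebesgue.
    ennreal \<bar>u x q\<bar> \<le> esssup (lebesgue_on S) (\<lambda>y. ennreal \<bar>u y q\<bar>)"
proof -
  let ?e = "\<lambda>q. esssup (lebesgue_on S) (\<lambda>y. ennreal \<bar>u y q\<bar>)"
  have SU: "S \<times> UNIV \<in> sets (lebesgue :: (real \<times> 'b) measure)"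
    using S by (intro sets_completionI_sets) (auto simp: borel_prod[symmetric])
  have "(\<lambda>z. if z \<in> S \<times> UNIV then (\<lambda>(x, q). u x q) z else 0) \<in> borel_measurable (lebesgue :: (real \<times> 'b) measure)"
    using assms(1) SU by (simp only: borel_measurable_if)
  then obtain v where v: "v \<in> borel_measurable (lborel :: (real \<times> 'b) measure)"
    "AE z in lborel. (if z \<in> S \<times> UNIV then (\<lambda>(x, q). u x q) z else 0) = v z"
    using completion_ex_borel_measurable_real by blast
  obtain N where N: "\<And>z. z \<in> space lborel - N \<Longrightarrow>
      (if z \<in> S \<times> UNIV then (\<lambda>(x, q). u x q) z else 0) = v z"
    "N \<in> null_sets (lborel :: (real \<times> 'b) measure)"
    by (rule AE_E3[OF v(2)]) (rule that)
  have vu: "v (x, q) = (if x \<in> S then u x q else 0)" if "(x, q) \<notin> N" for x q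
    using that N(1)[of "(x, q)"] by (cases "x \<in> S") simp_all
  have [measurable]: "N \<in> sets (lborel \<Otimes>\<^sub>M lborel)"
    using N(2) unfolding lborel_prod by (rule null_setsD2)
  have Nae: "AE z in lborel \<Otimes>\<^sub>M lborel. z \<notin> N"
    unfolding lborel_prod by (rule AE_not_in[OF N(2)])
  \<comment> \<open>Almost all sections of \<open>N\<close> are null in both directions:
    \<open>2\<close> serves to pass from \<open>u\<close> to \<open>v\<close>, and \<open>1\<close>
    to return after the exchange.\<close>
  have 1: "AE x in lborel. AE q in lborel. (x, q) \<notin> N"
    using lborel_pair.AE_pair[OF Nae] .
  have 2: "AE q in lborel. AE x in lborel. (x, q) \<notin> N"
  proof (rule lborel_pair.AE_commute[THEN iffD1, OF _ 1])
    show "{z \<in> space (lborel \<Otimes>\<^sub>M lborel). (fst z, snd z) \<notin> N} \<in> sets (lborel \<Otimes>\<^sub>M lborel)"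
      by measurable
  qed
  have "AE q in lborel. AE x in lborel. ennreal \<bar>v (x, q)\<bar> \<le> ?e q"
    using 2
  proof eventually_elim
    case (elim q)
    have "AE x in lebesgue_on S. ennreal \<bar>u x q\<bar> \<le> ?e q"
      by (rule esssup_AE)
    then have "AE x in lborel. x \<in> S \<longrightarrow> ennreal \<bar>u x q\<bar> \<le> ?e q"
      using S by (simp add: AE_restrict_space_iff AE_completion_iff)
    with elim show ?case
      by eventually_elim (auto simp: vu)
  qed
  then have "AE x in lborel. AE q in lborel. ennreal \<bar>v (x, q)\<bar> \<le> ?e q"
    using v(1) by (intro lborel_pair.AE_commute_le) (simp_all add: lborel_prod)
  with 1 have "AE x in lborel. x \<in> S \<longrightarrow> (AE q in lborel. ennreal \<bar>u x q\<bar> \<le> ?e q)"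
  proof eventually_elim
    case (elim x)
    show ?case
    proof
      assume "x \<in> S"
      from elim show "AE q in lborel. ennreal \<bar>u x q\<bar> \<le> ?e q"
        by eventually_elim (use \<open>x \<in> S\<close> in \<open>simp add: vu\<close>)
    qed
  qed
  then show ?thesis
    using S by (simp add: AE_restrict_space_iff AE_completion_iff)
qed

section \<open>Relativistic kinematics: bounds for \<open>g\<close>, \<open>s\<close> and the Moller
  velocity\<close>

lemma energy_ge_1: "1 \<le> energy p"
  by (simp add: energy_def)

lemma energy_power2: "(energy p)\<^sup>2 = 1 + (norm p)\<^sup>2"
  by (simp add: energy_def)

lemma norm_less_energy: "norm p < energy p"
  unfolding energy_def by (rule real_less_rsqrt) simp

text \<open>Cauchy-Schwarz for the vectors \<open>(1, p)\<close> and \<open>(1, q)\<close>. It makes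
  the radicand of \<open>rel_g\<close> non-negative.\<close>

lemma one_plus_inner_le_energy_mult: "1 + p \<bullet> q \<le> energy p * energy q"
proof -
  have "(1 + norm p * norm q)\<^sup>2 \<le> (energy p * energy q)\<^sup>2"
    unfolding power_mult_distrib energy_power2
    using zero_le_power2[of "norm p - norm q"] by (simp add: power2_eq_square algebra_simps)
  then have "1 + norm p * norm q \<le> energy p * energy q"
    by (rule power2_le_imp_le) (use energy_ge_1[of p] energy_ge_1[of q] in simp)
  with norm_cauchy_schwarz[of p q] show ?thesis by simp
qed

lemma rel_g_power2: "(rel_g p q)\<^sup>2 = 2 * (energy p * energy q - p \<bullet> q - 1)"
proof -
  have "(norm (p - q))\<^sup>2 - (energy p - energy q)\<^sup>2 = 2 * (energy p * energy q - p \<bullet> q - 1)"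
    using energy_power2[of p] energy_power2[of q]
    unfolding power2_norm_eq_inner by (simp add: power2_eq_square algebra_simps inner_commute)
  with one_plus_inner_le_energy_mult[of p q] show ?thesis
    by (simp add: rel_g_def)
qed

lemma rel_g_nonneg: "0 \<le> rel_g p q"
proof -
  have "0 \<le> (norm (p - q))\<^sup>2 - (energy p - energy q)\<^sup>2"
    using one_plus_inner_le_energy_mult[of p q] energy_power2[of p] energy_power2[of q]
    unfolding power2_norm_eq_inner by (simp add: power2_eq_square algebra_simps inner_commute)
  then show ?thesis by (simp add: rel_g_def)
qed

text \<open>The squared invariant mass of the total four-momentum, the form in which
  \<open>s\<close> enters the boost.\<close>

lemma rel_s_eq: "rel_s p q = (energy p + energy q)\<^sup>2 - (norm (p + q))\<^sup>2"
  using energy_power2[of p] energy_power2[of q]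
  unfolding rel_s_def rel_g_power2 power2_norm_eq_inner
  by (simp add: power2_eq_square algebra_simps inner_commute)

lemma rel_s_pos: "0 < rel_s p q"
  unfolding rel_s_def by (rule add_nonneg_pos) auto

lemma rel_g_self [simp]: "rel_g p p = 0"
  by (simp add: rel_g_def)

lemma minus_inner_le_energy_mult: "- (p \<bullet> q) \<le> energy p * energy q"
proof -
  have "norm p * norm q \<le> energy p * energy q"
    by (intro mult_mono) (use norm_less_energy[of p] norm_less_energy[of q] energy_ge_1[of p] in auto)
  with Cauchy_Schwarz_ineq2[of p q] show ?thesis by simp
qed

lemma rel_g_le: "rel_g p q \<le> 2 * sqrt (energy p * energy q)"
proof (rule power2_le_imp_le)
  show "(rel_g p q)\<^sup>2 \<le> (2 * sqrt (energy p * energy q))\<^sup>2"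
    using minus_inner_le_energy_mult[of p q] energy_ge_1[of p] energy_ge_1[of q]
    by (simp add: rel_g_power2 power_mult_distrib)
qed (use energy_ge_1[of p] energy_ge_1[of q] in simp)

lemma sqrt_rel_s_le: "sqrt (rel_s p q) \<le> 2 * sqrt (energy p * energy q)"
proof -
  have "1 * 1 \<le> energy p * energy q"
    by (intro mult_mono) (use energy_ge_1[of p] energy_ge_1[of q] in auto)
  \<comment> \<open>Here \<open>rel_s p q = 2 * (energy p * energy q - p \<bullet> q + 1)\<close>.
    The inequality at \<open>-p\<close>, which has the same energy, gives
    \<open>- (p \<bullet> q) \<le> energy p * energy q - 1\<close>, and the two ones cancel.\<close>
  then have "rel_s p q \<le> 4 * (energy p * energy q)"
    using one_plus_inner_le_energy_mult[of "-p" q]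
    by (simp add: rel_s_def rel_g_power2 energy_def)
  then have "sqrt (rel_s p q) \<le> sqrt (4 * (energy p * energy q))"
    by simp
  then show ?thesis by (simp add: real_sqrt_mult)
qed

lemma moller_nonneg: "0 \<le> moller p q"
  unfolding moller_def using rel_g_nonneg rel_s_pos energy_ge_1[of p] energy_ge_1[of q]
  by (simp add: less_imp_le)

text \<open>The bounds for \<open>g\<close> and \<open>sqrt s\<close> each contribute
  \<open>2 * sqrt (energy p * energy q)\<close>, and the denominator cancels the energies in their
  product.\<close>

lemma moller_le: "moller p q \<le> 4"
proof -
  have E: "0 < energy p * energy q"
    using energy_ge_1[of p] energy_ge_1[of q] by simp
  have "rel_g p q * sqrt (rel_s p q)
      \<le> (2 * sqrt (energy p * energy q)) * (2 * sqrt (energy p * energy q))"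
    by (intro mult_mono rel_g_le sqrt_rel_s_le) (use rel_s_pos E in \<open>auto simp: less_imp_le\<close>)
  also have "\<dots> = 4 * (energy p * energy q)"
    using E by simp
  finally show ?thesis
    unfolding moller_def using E by (subst pos_divide_le_eq) auto
qed

section \<open>The centre-of-momentum frame and the scattering angle\<close>

text \<open>The energy increases strictly less than the momentum changes: a difference of squares
  and Cauchy-Schwarz reduce this to \<open>norm p < energy p\<close>.\<close>

lemma rel_g_pos:
  assumes "p \<noteq> q"
  shows "0 < rel_g p q"
proof -
  have "\<bar>energy p - energy q\<bar> < norm (p - q)"
  proof -
    have E: "0 < energy p + energy q"
      using energy_ge_1[of p] energy_ge_1[of q] by simp
    have "\<bar>energy p - energy q\<bar> * (energy p + energy q) = \<bar>(energy p)\<^sup>2 - (energy q)\<^sup>2\<bar>"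
      using E by (simp add: square_diff_square_factored power2_eq_square abs_mult)
    also have "\<dots> = \<bar>(p - q) \<bullet> (p + q)\<bar>"
      by (simp add: energy_power2 power2_norm_eq_inner algebra_simps inner_commute)
    also have "\<dots> \<le> norm (p - q) * norm (p + q)"
      by (rule Cauchy_Schwarz_ineq2)
    also have "\<dots> < norm (p - q) * (energy p + energy q)"
      using assms norm_triangle_ineq[of p q] norm_less_energy[of p] norm_less_energy[of q]
      by (intro mult_strict_left_mono) auto
    finally show ?thesis using E by simp
  qed
  then have "\<bar>energy p - energy q\<bar>\<^sup>2 < (norm (p - q))\<^sup>2"
    by (rule power_strict_mono) auto
  then show ?thesis by (simp add: rel_g_def)
qed

text \<open>For equal masses the sum and the difference of the four-momenta are
  Minkowski-orthogonal.\<close>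

lemma inner_eq_energy_diff: "(p + q) \<bullet> (p - q) = (energy p + energy q) * (energy p - energy q)"
  using energy_power2[of p] energy_power2[of q] unfolding power2_norm_eq_inner
  by (simp add: algebra_simps power2_eq_square inner_commute)

text \<open>The right-hand side is the form of the boost coefficient without the removable singularity
  at \<open>P = 0\<close>.\<close>

lemma boost_coefficient:
  fixes P \<omega> :: "real^3"
  assumes r: "0 < r" "r\<^sup>2 = E\<^sup>2 - (norm P)\<^sup>2" and E: "0 < E"
  shows "((E / r - 1) * ((P \<bullet> \<omega>) / (norm P)\<^sup>2)) = (P \<bullet> \<omega>) / (r * (E + r))"
proof (cases "P = 0")
  case False
  then have n: "(norm P)\<^sup>2 \<noteq> 0" by simp
  have "(norm P)\<^sup>2 = (E - r) * (E + r)"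
    using r(2) by (simp add: algebra_simps power2_eq_square)
  moreover have "(E / r - 1) * r = E - r" using r(1) by (simp add: field_simps)
  ultimately show ?thesis
    using n r(1) E by (simp add: divide_simps)
qed simp

text \<open>In the centre-of-momentum frame the particle has energy \<open>r / 2\<close> and
  momentum \<open>g / 2\<close> times \<open>\<omega>\<close>, and the right-hand side is its
  boosted energy. The sign of \<open>g\<close> is left free so that both outgoing particles are
  covered.\<close>

lemma energy_boosted:
  fixes P \<omega> :: "real^3"
  assumes r: "0 < r" "r\<^sup>2 = E\<^sup>2 - (norm P)\<^sup>2" "r\<^sup>2 = g\<^sup>2 + 4" and E: "0 < E" and w: "norm \<omega> = 1"
  shows "energy ((1/2) *\<^sub>R P + (g / 2) *\<^sub>R (\<omega> + ((P \<bullet> \<omega>) / (r * (E + r))) *\<^sub>R P))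
    = (E + g * (P \<bullet> \<omega>) / r) / 2"
proof -
  define a where "a = P \<bullet> \<omega>"
  define c where "c = a / (r * (E + r))"
  have PP: "P \<bullet> P = (E - r) * (E + r)"
    using r(2) power2_norm_eq_inner[of P] by (simp add: algebra_simps power2_eq_square)
  have ww: "\<omega> \<bullet> \<omega> = 1" using w by (simp add: power2_norm_eq_inner[symmetric])
  define e where "e = a / r"
  have cr: "c * (E + r) = e" and ar: "a = e * r"
    using r(1) E by (simp_all add: c_def e_def)
  \<comment> \<open>The boost sends the four-vector \<open>(0, \<omega>)\<close> to
    \<open>(e, \<omega> + c *\<^sub>R P)\<close>. Facts \<open>1\<close> and \<open>2\<close>
    express that it stays orthogonal to \<open>(E, P)\<close> and keeps its Minkowski
    length.\<close>
  have 1: "P \<bullet> (\<omega> + c *\<^sub>R P) = e * E"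
  proof -
    have "P \<bullet> (\<omega> + c *\<^sub>R P) = a + (c * (E + r)) * (E - r)"
      by (simp add: inner_add_right a_def PP)
    then show ?thesis unfolding cr by (simp add: ar algebra_simps)
  qed
  have 2: "(norm (\<omega> + c *\<^sub>R P))\<^sup>2 = 1 + e\<^sup>2"
  proof -
    have "(norm (\<omega> + c *\<^sub>R P))\<^sup>2 = 1 + 2 * c * a + c * (c * (E + r)) * (E - r)"
      by (simp add: power2_norm_eq_inner inner_add inner_commute[of \<omega> P] ww PP a_def algebra_simps)
    also have "\<dots> = 1 + 2 * c * a + c * e * (E - r)"
      unfolding cr ..
    also have "\<dots> = 1 + (c * (E + r)) * e"
      by (simp add: ar algebra_simps)
    finally show ?thesis unfolding cr by (simp add: power2_eq_square)
  qed
  have "(norm ((1/2) *\<^sub>R P + (g / 2) *\<^sub>R (\<omega> + c *\<^sub>R P)))\<^sup>2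
      = (norm P)\<^sup>2 / 4 + g / 2 * (P \<bullet> (\<omega> + c *\<^sub>R P)) + g\<^sup>2 / 4 * (norm (\<omega> + c *\<^sub>R P))\<^sup>2"
    unfolding power2_norm_eq_inner
    by (simp add: inner_add inner_commute algebra_simps power2_eq_square)
  then have sq: "1 + (norm ((1/2) *\<^sub>R P + (g / 2) *\<^sub>R (\<omega> + c *\<^sub>R P)))\<^sup>2 = ((E + g * e) / 2)\<^sup>2"
    unfolding 1 2 using r(2,3) by (simp add: power2_eq_square field_simps)
  \<comment> \<open>The identity \<open>sq\<close> fixes the energy up to sign; the rest shows that
    the claimed value is non-negative.\<close>
  have "\<bar>g\<bar> \<le> r"
    by (rule power2_le_imp_le) (use r(1,3) in auto)
  moreover have "\<bar>a\<bar> \<le> E"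
  proof -
    have "\<bar>a\<bar> \<le> norm P" using Cauchy_Schwarz_ineq2[of P \<omega>] w by (simp add: a_def)
    also have "norm P \<le> E"
      by (rule power2_le_imp_le) (use r(2) E zero_le_power2[of r] in linarith)+
    finally show ?thesis .
  qed
  ultimately have "\<bar>g\<bar> * \<bar>a\<bar> \<le> r * E"
    by (intro mult_mono) auto
  then have "- (g * a) \<le> r * E"
    by (simp flip: abs_mult)
  then have "0 \<le> (E + g * e) / 2"
    using r(1) by (simp add: e_def field_simps)
  then show ?thesis
    unfolding energy_def using sq by (simp add: c_def a_def e_def)
qed

text \<open>The cosine equals \<open>w \<bullet> \<omega> / g\<close>, where \<open>w\<close> is \<open>p - q\<close> boosted to the centre-of-momentum
  frame; there the energies of both particles agree, so \<open>|w| = g\<close>.\<close>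

lemma abs_cos_scatter_angle_le:
  assumes pq: "p \<noteq> q" and w: "norm \<omega> = 1"
  shows "\<bar>(- (energy p - energy q) * (energy (post_p p q \<omega>) - energy (post_q p q \<omega>))
        + (p - q) \<bullet> (post_p p q \<omega> - post_q p q \<omega>)) / (rel_g p q)\<^sup>2\<bar> \<le> 1"
proof -
  define g P E r a where "g = rel_g p q" "P = p + q" "E = energy p + energy q"
    "r = sqrt (rel_s p q)" "a = P \<bullet> \<omega>"
  note defs = this
  define d where "d = energy p - energy q"
  \<comment> \<open>The momentum part of the boosted four-vector \<open>(d, p - q)\<close>; its
    coefficient takes this short form because \<open>P \<bullet> (p - q) = E * d\<close>.\<close>
  define w where "w = (p - q) - (d / (E + r)) *\<^sub>R P"
  have g: "0 < g" using rel_g_pos[OF pq] by (simp add: defs)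
  have E: "0 < E" using energy_ge_1[of p] energy_ge_1[of q] by (simp add: defs)
  have r: "0 < r" "r\<^sup>2 = E\<^sup>2 - (norm P)\<^sup>2" "r\<^sup>2 = g\<^sup>2 + 4"
    using rel_s_pos[of p q] rel_s_eq[of p q] by (simp_all add: defs rel_s_def)
  have coeff: "(E / r - 1) * (a / (norm P)\<^sup>2) = a / (r * (E + r))"
    using boost_coefficient[OF r(1,2) E, of \<omega>] by (simp add: defs(5))
  have p': "post_p p q \<omega> = (1/2) *\<^sub>R P + (g / 2) *\<^sub>R (\<omega> + (a / (r * (E + r))) *\<^sub>R P)"
    unfolding post_p_def Let_def defs[symmetric] coeff ..
  have half: "(1/2) *\<^sub>R P + (1/2) *\<^sub>R P = P"
    by (simp flip: scaleR_add_left)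
  \<comment> \<open>The second particle leaves in the opposite direction, which amounts to replacing
    \<open>g\<close> by \<open>- g\<close>.\<close>
  have q': "post_q p q \<omega> = (1/2) *\<^sub>R P + ((- g) / 2) *\<^sub>R (\<omega> + (a / (r * (E + r))) *\<^sub>R P)"
    unfolding post_q_def p' defs(2)[symmetric] by (subst half[symmetric]) simp
  have diff: "post_p p q \<omega> - post_q p q \<omega> = g *\<^sub>R (\<omega> + (a / (r * (E + r))) *\<^sub>R P)"
    unfolding p' q' by (simp flip: scaleR_add_left)
  have Ep: "energy (post_p p q \<omega>) = (E + g * a / r) / 2"
    unfolding p' defs(5) by (rule energy_boosted[OF r E assms(2)])
  have Eq: "energy (post_q p q \<omega>) = (E + (- g) * a / r) / 2"
    unfolding q' defs(5) by (rule energy_boosted[OF r(1,2) _ E assms(2)]) (use r in simp)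
  have Ed: "energy (post_p p q \<omega>) - energy (post_q p q \<omega>) = g * a / r"
    unfolding Ep Eq by (simp add: field_simps)
  have Pd: "P \<bullet> (p - q) = E * d"
    unfolding defs d_def by (rule inner_eq_energy_diff)
  \<comment> \<open>Invariance of the Minkowski product: in the centre-of-momentum frame both energy
    differences vanish, leaving the product of \<open>w\<close> and
    \<open>g *\<^sub>R \<omega>\<close>.\<close>
  have "- d * (g * a / r) + (p - q) \<bullet> (g *\<^sub>R (\<omega> + (a / (r * (E + r))) *\<^sub>R P)) = g * (w \<bullet> \<omega>)"
  proof -
    have "- d * (g * a / r) + (p - q) \<bullet> (g *\<^sub>R (\<omega> + (a / (r * (E + r))) *\<^sub>R P))
        = g * ((p - q) \<bullet> \<omega> + a * (d * (E / (r * (E + r)) - 1 / r)))"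
      using Pd by (simp add: inner_add_right inner_diff_left inner_diff_right inner_commute[of p P] inner_commute[of q P] algebra_simps)
    also have "E / (r * (E + r)) - 1 / r = - 1 / (E + r)"
      using r(1) E by (simp add: divide_simps)
    finally show ?thesis
      by (simp add: w_def inner_diff_left defs)
  qed
  then have num: "- d * (energy (post_p p q \<omega>) - energy (post_q p q \<omega>))
        + (p - q) \<bullet> (post_p p q \<omega> - post_q p q \<omega>) = g * (w \<bullet> \<omega>)"
    unfolding Ed diff .
  have "(norm w)\<^sup>2 = g\<^sup>2"
  proof -
    define c where "c = d / (E + r)"
    have cE: "c * (E + r) = d" using r(1) E by (simp add: c_def)
    have PP: "P \<bullet> P = (E - r) * (E + r)"
      using r(2) power2_norm_eq_inner[of P] by (simp add: algebra_simps power2_eq_square)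
    have "(norm w)\<^sup>2 = (norm (p - q))\<^sup>2 - 2 * c * (P \<bullet> (p - q)) + c\<^sup>2 * (P \<bullet> P)"
      unfolding w_def c_def[symmetric] power2_norm_eq_inner
      by (simp add: inner_diff_left inner_diff_right inner_commute algebra_simps power2_eq_square)
    also have "\<dots> = (norm (p - q))\<^sup>2 - 2 * c * E * d + c * d * (E - r)"
      using cE by (simp add: Pd PP power2_eq_square mult.commute mult.left_commute)
    also have "\<dots> = (norm (p - q))\<^sup>2 - (c * (E + r)) * d"
      by (simp add: algebra_simps)
    finally have "(norm w)\<^sup>2 = (norm (p - q))\<^sup>2 - d\<^sup>2"
      unfolding cE by (simp add: power2_eq_square)
    moreover have "g\<^sup>2 = (norm (p - q))\<^sup>2 - d\<^sup>2"
      using g unfolding defs rel_g_def d_def by simp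
    ultimately show ?thesis by simp
  qed
  then have "norm w = g" using g by (simp add: power2_eq_iff_nonneg)
  then have "\<bar>w \<bullet> \<omega>\<bar> \<le> g"
    using Cauchy_Schwarz_ineq2[of w \<omega>] assms(2) by simp
  moreover have "g * (w \<bullet> \<omega>) / g\<^sup>2 = (w \<bullet> \<omega>) / g"
    by (simp add: power2_eq_square)
  ultimately show ?thesis
    using num g by (simp add: d_def defs(1)[symmetric] abs_divide)
qed

lemma scatter_angle_in_range:
  assumes "p \<noteq> q" "norm \<omega> = 1"
  shows "scatter_angle p q \<omega> \<in> {0..pi}"
  using abs_cos_scatter_angle_le[OF assms, THEN abs_le_D1]
    abs_cos_scatter_angle_le[OF assms, THEN abs_le_D2]
  unfolding scatter_angle_def atLeastAtMost_iff
  by (intro conjI arccos_lbound arccos_ubound) linarith+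

section \<open>Kernel bounds and estimates for the loss operator\<close>

lemma space_sphere_measure: "space sphere_measure = sphere 0 1"
  by (simp add: sphere_measure_def space_restrict_space)

lemma finite_measure_sphere_measure: "finite_measure sphere_measure"
  by (rule finite_measureI) (simp add: space_sphere_measure emeasure_sphere_measure_space)

text \<open>The factor \<open>1 / (4 * pi)\<close> comes from the bound on
  \<open>\<sigma>\<^sub>0\<close> and is kept separate because the area of the sphere cancels it
  later.\<close>

lemma hard_sphere_kernel_upper_bound:
  assumes "hard_sphere_kernel \<sigma> \<sigma>\<^sub>0 c\<^sub>0"
  obtains b where "0 < b"
    "\<And>g \<theta>. 0 \<le> g \<Longrightarrow> \<theta> \<in> {0..pi} \<Longrightarrow> 0 \<le> \<sigma> g \<theta> \<and> \<sigma> g \<theta> \<le> b / (4 * pi) * g"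
proof -
  from assms obtain b where b: "0 < b"
    and u: "\<And>g \<theta>. 0 \<le> g \<Longrightarrow> \<theta> \<in> {0..pi} \<Longrightarrow> \<sigma> g \<theta> \<le> b * (g * \<sigma>\<^sub>0 \<theta>)"
    unfolding hard_sphere_kernel_def by blast
  have n: "\<And>g \<theta>. 0 \<le> g \<Longrightarrow> \<theta> \<in> {0..pi} \<Longrightarrow> 0 \<le> \<sigma> g \<theta>"
    and m: "\<And>\<theta>. \<theta> \<in> {0..pi} \<Longrightarrow> \<sigma>\<^sub>0 \<theta> \<le> 1 / (4 * pi)"
    using assms unfolding hard_sphere_kernel_def by blast+
  have "\<sigma> g \<theta> \<le> b / (4 * pi) * g" if "0 \<le> g" "\<theta> \<in> {0..pi}" for g \<theta>
  proof -
    have "b * (g * \<sigma>\<^sub>0 \<theta>) \<le> b * (g * (1 / (4 * pi)))"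
      using b that m by (intro mult_left_mono) auto
    with u[OF that] show ?thesis by simp
  qed
  with b n show ?thesis by (intro that) auto
qed

lemma abs_loss_integrand_le:
  assumes \<sigma>: "\<And>g \<theta>. 0 \<le> g \<Longrightarrow> \<theta> \<in> {0..pi} \<Longrightarrow> 0 \<le> \<sigma> g \<theta> \<and> \<sigma> g \<theta> \<le> c * g"
    and c: "0 \<le> c" and \<omega>: "norm \<omega> = 1"
  shows "\<bar>loss_integrand \<sigma> u x p q \<omega>\<bar> \<le> 8 * c * (sqrt (energy p) * (sqrt (energy q) * \<bar>u x q\<bar>))"
proof (cases "p = q")
  \<comment> \<open>The angle is controlled for distinct momenta; on the diagonal the factor
    \<open>moller\<close> makes the integrand zero.\<close>
  case True
  with c show ?thesis
    by (simp add: loss_integrand_def moller_def energy_def)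
next
  case False
  let ?g = "rel_g p q" and ?\<theta> = "scatter_angle p q \<omega>"
  have s: "0 \<le> \<sigma> ?g ?\<theta>" "\<sigma> ?g ?\<theta> \<le> c * ?g"
    using \<sigma>[OF rel_g_nonneg scatter_angle_in_range[OF False \<omega>]] by auto
  note s(2)
  also have "c * ?g \<le> c * (2 * sqrt (energy p * energy q))"
    using c rel_g_le by (rule mult_left_mono[rotated])
  finally have "moller p q * \<sigma> ?g ?\<theta> \<le> 4 * (c * (2 * sqrt (energy p * energy q)))"
    by (intro mult_mono moller_le) (use s(1) in auto)
  then have "moller p q * \<sigma> ?g ?\<theta> * \<bar>u x q\<bar> \<le> 4 * (c * (2 * sqrt (energy p * energy q))) * \<bar>u x q\<bar>"
    by (rule mult_right_mono) simp
  then show ?thesis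
    using s(1) moller_nonneg[of p q]
    by (simp add: loss_integrand_def abs_mult real_sqrt_mult mult_ac)
qed

text \<open>Absolute convergence turns both iterated integrals into integrals over the product,
  where the difference has the loss integrand of \<open>f - h\<close>. Tonelli and the pointwise
  bound then apply; the factor \<open>8\<close> is \<open>4\<close> from the Moller velocity times
  \<open>2\<close> from the bound on \<open>g\<close>.\<close>

lemma loss_op_diff_le:
  assumes \<sigma>: "\<And>g \<theta>. 0 \<le> g \<Longrightarrow> \<theta> \<in> {0..pi} \<Longrightarrow> 0 \<le> \<sigma> g \<theta> \<and> \<sigma> g \<theta> \<le> b / (4 * pi) * g"
    and b: "0 < b" and fin: "loss_finite \<sigma> f x p" "loss_finite \<sigma> h x p"
  shows "ennreal \<bar>loss_op \<sigma> f x p - loss_op \<sigma> h x p\<bar>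
    \<le> ennreal (8 * b) * (ennreal (energy p powr (1/2)) * norm_L1_half (\<lambda>q. f x q - h x q))"
proof -
  interpret S: finite_measure sphere_measure by (rule finite_measure_sphere_measure)
  interpret L: sigma_finite_measure "lebesgue :: (real^3) measure"
    by (rule sigma_finite_completion) (rule sigma_finite_lborel)
  interpret pair_sigma_finite "lebesgue :: (real^3) measure" sphere_measure ..
  let ?P = "(lebesgue :: (real^3) measure) \<Otimes>\<^sub>M sphere_measure"
  let ?u = "\<lambda>x q. f x q - h x q"
  let ?F = "\<lambda>f (q, \<omega>). loss_integrand \<sigma> f x p q \<omega>"
  have int: "integrable ?P (?F f)" "integrable ?P (?F h)"
    using fin by (simp_all add: loss_finite_def)
  have diff: "?F f z - ?F h z = ?F ?u z" for z
    by (cases z) (simp add: loss_integrand_def right_diff_distrib)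
  have intu: "integrable ?P (?F ?u)"
    using Bochner_Integration.integrable_diff[OF int] by (simp only: diff)
  have "loss_op \<sigma> f x p - loss_op \<sigma> h x p = integral\<^sup>L ?P (?F f) - integral\<^sup>L ?P (?F h)"
    unfolding loss_op_def using integral_fst'[OF int(1)] integral_fst'[OF int(2)] by simp
  also have "\<dots> = integral\<^sup>L ?P (?F ?u)"
    using Bochner_Integration.integral_diff[OF int] by (simp only: diff)
  finally have "ennreal \<bar>loss_op \<sigma> f x p - loss_op \<sigma> h x p\<bar> \<le> (\<integral>\<^sup>+z. ennreal \<bar>?F ?u z\<bar> \<partial>?P)"
    using integral_norm_bound_ennreal[OF intu] by simp
  also have "\<dots> = (\<integral>\<^sup>+q. \<integral>\<^sup>+\<omega>. ennreal \<bar>loss_integrand \<sigma> ?u x p q \<omega>\<bar> \<partial>sphere_measure \<partial>lebesgue)"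
    using borel_measurable_integrable[OF intu]
    by (subst S.nn_integral_fst[symmetric]) auto
  also have "\<dots> \<le> (\<integral>\<^sup>+q. ennreal (8 * b * sqrt (energy p)) * ennreal (energy q powr (1/2) * \<bar>?u x q\<bar>) \<partial>lebesgue)"
  proof (rule nn_integral_mono)
    fix q :: "real^3"
    let ?K = "8 * (b / (4 * pi)) * (sqrt (energy p) * (sqrt (energy q) * \<bar>?u x q\<bar>))"
    have "(\<integral>\<^sup>+\<omega>. ennreal \<bar>loss_integrand \<sigma> ?u x p q \<omega>\<bar> \<partial>sphere_measure) \<le> (\<integral>\<^sup>+\<omega>. ennreal ?K \<partial>sphere_measure)"
      using b abs_loss_integrand_le[of \<sigma> "b / (4 * pi)", OF \<sigma>]
      by (intro nn_integral_mono ennreal_leI) (simp add: space_sphere_measure)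
    also have "\<dots> = ennreal (?K * (4 * pi))"
      unfolding nn_integral_const space_sphere_measure emeasure_sphere_measure_space
      by (rule ennreal_mult''[symmetric]) simp
    also have "?K * (4 * pi) = 8 * b * sqrt (energy p) * (energy q powr (1/2) * \<bar>?u x q\<bar>)"
      using energy_ge_1[of q] by (simp add: powr_half_sqrt)
    also have "ennreal \<dots> = ennreal (8 * b * sqrt (energy p)) * ennreal (energy q powr (1/2) * \<bar>?u x q\<bar>)"
      by (rule ennreal_mult'') simp
    finally show "(\<integral>\<^sup>+\<omega>. ennreal \<bar>loss_integrand \<sigma> ?u x p q \<omega>\<bar> \<partial>sphere_measure)
      \<le> ennreal (8 * b * sqrt (energy p)) * ennreal (energy q powr (1/2) * \<bar>?u x q\<bar>)" .
  qed
  also have "\<dots> \<le> ennreal (8 * b * sqrt (energy p)) * norm_L1_half (?u x)"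
    unfolding norm_L1_half_def
    by (rule nn_integral_cmult_le) (use b energy_ge_1[of p] in simp)
  also have "ennreal (8 * b * sqrt (energy p)) = ennreal (8 * b) * ennreal (energy p powr (1/2))"
    using b energy_ge_1[of p] by (simp add: powr_half_sqrt ennreal_mult'')
  finally show ?thesis by (simp add: mult.assoc)
qed

text \<open>Inserting the factor \<open>r * \<phi> p\<close>, which is at least \<open>1\<close>,
  and passing from the section to the essential supremum both enlarge the integrand almost
  everywhere.\<close>

lemma norm_L1_half_le_norm_weighted:
  assumes u: "(\<lambda>(x, p). u x p) \<in> borel_measurable (lebesgue_on ({0..1} \<times> UNIV))"
    and \<phi>: "\<And>p. 1 \<le> r * \<phi> p" and r: "0 < r"
  shows "AE x in lebesgue_on {0..1}. norm_L1_half (u x) \<le> ennreal r * norm_weighted \<phi> u"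
  using AE_section_le_esssup[OF u]
proof (rule eventually_mono)
  let ?e = "\<lambda>p. esssup (lebesgue_on {0..1}) (\<lambda>x. ennreal \<bar>u x p\<bar>)"
  fix x assume x: "AE q in lebesgue. ennreal \<bar>u x q\<bar> \<le> ?e q"
  have "norm_L1_half (u x) \<le> (\<integral>\<^sup>+p. ennreal r * (?e p * ennreal (energy p powr (1/2) * \<phi> p)) \<partial>lebesgue)"
    unfolding norm_L1_half_def
  proof (rule nn_integral_mono_AE, use x in eventually_elim)
    case (elim p)
    have "ennreal (energy p powr (1/2) * \<bar>u x p\<bar>) = ennreal \<bar>u x p\<bar> * ennreal (energy p powr (1/2))"
      by (simp add: ennreal_mult mult.commute)
    also have "\<dots> \<le> ?e p * ennreal (r * (energy p powr (1/2) * \<phi> p))"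
    proof (intro mult_mono elim ennreal_leI)
      show "energy p powr (1/2) \<le> r * (energy p powr (1/2) * \<phi> p)"
        using mult_left_mono[OF \<phi>[of p], of "energy p powr (1/2)"] by (simp add: mult_ac)
    qed auto
    also have "\<dots> = ennreal r * (?e p * ennreal (energy p powr (1/2) * \<phi> p))"
      using r by (simp add: ennreal_mult' mult_ac)
    finally show ?case .
  qed
  also have "\<dots> \<le> ennreal r * norm_weighted \<phi> u"
    unfolding norm_weighted_def by (rule nn_integral_cmult_le[OF r])
  finally show "norm_L1_half (u x) \<le> ennreal r * norm_weighted \<phi> u" .
qed simp

theorem lemma2p2:
  fixes \<sigma> :: "real \<Rightarrow> real \<Rightarrow> real" and \<sigma>\<^sub>0 :: "real \<Rightarrow> real" and c\<^sub>0 :: real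
  assumes kernel: "hard_sphere_kernel \<sigma> \<sigma>\<^sub>0 c\<^sub>0"
  shows "\<exists>C>0. \<forall>k>0. \<forall>f h :: real \<Rightarrow> real^3 \<Rightarrow> real.
    (\<lambda>(x, p). f x p) \<in> borel_measurable (lebesgue_on ({0..1} \<times> UNIV)) \<longrightarrow>
    (\<lambda>(x, p). h x p) \<in> borel_measurable (lebesgue_on ({0..1} \<times> UNIV)) \<longrightarrow>
    (AE x in lebesgue_on {0..1}. \<forall>p. loss_finite \<sigma> f x p \<and> loss_finite \<sigma> h x p) \<longrightarrow>
    (AE x in lebesgue_on {0..1}. norm_L1_half (\<lambda>p. f x p - h x p) < \<infinity>) \<longrightarrow>
    norm_weighted (\<lambda>p. exp (k * energy p)) (\<lambda>x p. f x p - h x p) < \<infinity> \<longrightarrow>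
    (AE x in lebesgue_on {0..1}. \<forall>p.
       ennreal \<bar>loss_op \<sigma> f x p - loss_op \<sigma> h x p\<bar>
         \<le> ennreal C * min
             (ennreal (energy p powr (1/2)) * norm_L1_half (\<lambda>q. f x q - h x q))
             (ennreal (exp (- k / sqrt 2) * energy p powr (1/2))
                * norm_weighted (\<lambda>p. exp (k * energy p)) (\<lambda>y q. f y q - h y q)))"
proof -
  obtain b where b: "0 < b"
    and \<sigma>: "\<And>g \<theta>. 0 \<le> g \<Longrightarrow> \<theta> \<in> {0..pi} \<Longrightarrow> 0 \<le> \<sigma> g \<theta> \<and> \<sigma> g \<theta> \<le> b / (4 * pi) * g"
    using hard_sphere_kernel_upper_bound[OF kernel] by blast
  show ?thesis
  \<comment> \<open>The number \<open>b\<close> is obtained from the kernel before \<open>k\<close>,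
    \<open>f\<close> and \<open>h\<close> are fixed, so the constant is uniform in them.\<close>
  proof (intro exI[of _ "8 * b"] conjI allI impI)
    fix k :: real and f h :: "real \<Rightarrow> real^3 \<Rightarrow> real"
    assume k: "0 < k"
      and f: "(\<lambda>(x, p). f x p) \<in> borel_measurable (lebesgue_on ({0..1} \<times> UNIV))"
      and h: "(\<lambda>(x, p). h x p) \<in> borel_measurable (lebesgue_on ({0..1} \<times> UNIV))"
      and fin: "AE x in lebesgue_on {0..1}. \<forall>p. loss_finite \<sigma> f x p \<and> loss_finite \<sigma> h x p"
    let ?u = "\<lambda>x p. f x p - h x p"
    let ?N = "norm_weighted (\<lambda>p. exp (k * energy p)) ?u"
    have "1 \<le> exp (- k / sqrt 2) * exp (k * energy p)" for p
    proof -
      \<comment> \<open>The decay factor arises from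
        \<open>1 / sqrt 2 \<le> 1 \<le> energy p\<close>.\<close>
      have "1 \<le> sqrt 2 * energy p"
        using mult_mono[of 1 "sqrt 2" 1 "energy p"] energy_ge_1[of p] by simp
      then have "k / sqrt 2 \<le> k * energy p"
        using k by (simp add: field_simps)
      then show ?thesis by (simp flip: exp_add)
    qed
    moreover have "(\<lambda>(x, p). ?u x p) \<in> borel_measurable (lebesgue_on ({0..1} \<times> UNIV))"
      using borel_measurable_diff[OF f h] by (simp add: case_prod_unfold)
    ultimately have "AE x in lebesgue_on {0..1}. norm_L1_half (?u x) \<le> ennreal (exp (- k / sqrt 2)) * ?N"
      by (intro norm_L1_half_le_norm_weighted) auto
    with fin show "AE x in lebesgue_on {0..1}. \<forall>p. ennreal \<bar>loss_op \<sigma> f x p - loss_op \<sigma> h x p\<bar>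
         \<le> ennreal (8 * b) * min (ennreal (energy p powr (1/2)) * norm_L1_half (?u x))
             (ennreal (exp (- k / sqrt 2) * energy p powr (1/2)) * ?N)"
    proof eventually_elim
      case (elim x)
      show ?case
      proof
        fix p
        \<comment> \<open>For almost every \<open>x\<close> the first entry is the minimum, so the
          bound by the first norm is enough.\<close>
        have "ennreal (energy p powr (1/2)) * norm_L1_half (?u x)
            \<le> ennreal (exp (- k / sqrt 2) * energy p powr (1/2)) * ?N"
          using mult_left_mono[OF elim(2), of "ennreal (energy p powr (1/2))"]
          by (simp add: ennreal_mult mult_ac)
        then show "ennreal \<bar>loss_op \<sigma> f x p - loss_op \<sigma> h x p\<bar>
         \<le> ennreal (8 * b) * min (ennreal (energy p powr (1/2)) * norm_L1_half (?u x))
             (ennreal (exp (- k / sqrt 2) * energy p powr (1/2)) * ?N)"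
          using loss_op_diff_le[OF \<sigma> b, where f = f and h = h and x = x and p = p] elim(1) by (simp add: min_absorb1)
      qed
    qed
  qed (use b in simp)
qed

end
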